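(* Let $(U_A,\tau)$ and $(U_B,\delta)$ be soft topological spaces and $f:U_A\to U_B$ a soft function. Then $f$ is soft semiopen if and only if $f((F_A)^0)\subseteq\mathrm{ssint}(f(F_A))$ for every soft set $F_A$ of $U_A$.
   Context: Soft sets. For a universe $U$ and a parameter set $A$, a soft set $F_A$ over $U$ is a map $F:A\to\mathcal P(U)$; $SS(U)_A$ is the set of all of them. $\Phi_A$ has all values $\emptyset$; $U_A$ has all values $U$. Soft inclusion, union, intersection and complement ($(F_A)^c$) are taken parameterwise. "A soft set of $U_A$" means a member of $SS(U)_A$; likewise for $U_B$ with parameter set $B$. Soft topology. A soft topology is a family $\tau\subseteq SS(U)_A$ containing $\Phi_A,U_A$, closed under arbitrary soft unions and under soft intersections of two members; $(U_A,\tau)$ is then a soft topological space. Members of $\tau$ are the open soft sets, their complements the closed soft sets. $\overline{F_A}$ is the intersection of all closed soft sets containing $F_A$, and $(F_A)^0$ is the union of all open soft sets contained in $F_A$. A soft set $G_A$ is semiopen if there is an open soft set $H_A$ with $H_A\subseteq G_A\subseteq\overline{H_A}$. $\mathrm{ssint}\,G_A$ is the union of all semiopen soft sets contained in $G_A$. A soft function $f:U_A\to U_B$ is given by maps $u:U\to U$ and $p:A\to B$; for $F_A\in SS(U)_A$ the image is $f(F_A)(b)=\bigcup_{a\in p^{-1}(b)}u(F(a))$ for $b\in B$, and for $G_B\in SS(U)_B$ the inverse image is $f^{-1}(G_B)(a)=u^{-1}(G(p(a)))$ for $a\in A$. It is soft semiopen if $f(G_A)$ is a semiopen soft set of $U_B$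 for each open soft set $G_A$ of $U_A$. *)

theory Defs
  imports Main "HOL-Library.FuncSet"
begin

text \<open>
  The universe \<open>U\<close> and the parameter set \<open>A\<close> are arbitrary sets. A soft set over \<open>U\<close> with
  parameters in \<open>A\<close> is an extensional function (equal to \<open>undefined\<close> off \<open>A\<close>), so that
  HOL equality of members of \<open>soft_sets U A\<close> is equality of maps \<open>A \<rightarrow> Pow U\<close>. All
  operations below are therefore restricted to the parameter set.
\<close>

definition soft_sets :: "'u set \<Rightarrow> 'a set \<Rightarrow> ('a \<Rightarrow> 'u set) set" where
  "soft_sets U A = (A \<rightarrow>\<^sub>E Pow U)"

definition soft_empty :: "'a set \<Rightarrow> 'a \<Rightarrow> 'u set" where
  "soft_empty A = (\<lambda>a\<in>A. {})"

definition soft_full :: "'u set \<Rightarrow> 'a set \<Rightarrow> 'a \<Rightarrow> 'u set" where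
  "soft_full U A = (\<lambda>a\<in>A. U)"

definition soft_subset :: "'a set \<Rightarrow> ('a \<Rightarrow> 'u set) \<Rightarrow> ('a \<Rightarrow> 'u set) \<Rightarrow> bool" where
  "soft_subset A F G \<longleftrightarrow> (\<forall>a\<in>A. F a \<subseteq> G a)"

definition soft_Union :: "'a set \<Rightarrow> ('a \<Rightarrow> 'u set) set \<Rightarrow> 'a \<Rightarrow> 'u set" where
  "soft_Union A S = (\<lambda>a\<in>A. \<Union>F\<in>S. F a)"

text \<open>The intersection of the empty family is the full soft set.\<close>

definition soft_Inter :: "'u set \<Rightarrow> 'a set \<Rightarrow> ('a \<Rightarrow> 'u set) set \<Rightarrow> 'a \<Rightarrow> 'u set" where
  "soft_Inter U A S = (\<lambda>a\<in>A. U \<inter> (\<Inter>F\<in>S. F a))"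

definition soft_inter :: "'a set \<Rightarrow> ('a \<Rightarrow> 'u set) \<Rightarrow> ('a \<Rightarrow> 'u set) \<Rightarrow> 'a \<Rightarrow> 'u set" where
  "soft_inter A F G = (\<lambda>a\<in>A. F a \<inter> G a)"

definition soft_compl :: "'u set \<Rightarrow> 'a set \<Rightarrow> ('a \<Rightarrow> 'u set) \<Rightarrow> 'a \<Rightarrow> 'u set" where
  "soft_compl U A F = (\<lambda>a\<in>A. U - F a)"

definition soft_topology :: "'u set \<Rightarrow> 'a set \<Rightarrow> ('a \<Rightarrow> 'u set) set \<Rightarrow> bool" where
  "soft_topology U A \<tau> \<longleftrightarrow>
     \<tau> \<subseteq> soft_sets U A \<and>
     soft_empty A \<in> \<tau> \<and>
     soft_full U A \<in> \<tau> \<and>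
     (\<forall>S. S \<subseteq> \<tau> \<longrightarrow> soft_Union A S \<in> \<tau>) \<and>
     (\<forall>F\<in>\<tau>. \<forall>G\<in>\<tau>. soft_inter A F G \<in> \<tau>)"

definition soft_closed_sets :: "'u set \<Rightarrow> 'a set \<Rightarrow> ('a \<Rightarrow> 'u set) set \<Rightarrow> ('a \<Rightarrow> 'u set) set" where
  "soft_closed_sets U A \<tau> = soft_compl U A ` \<tau>"

definition soft_closure ::
    "'u set \<Rightarrow> 'a set \<Rightarrow> ('a \<Rightarrow> 'u set) set \<Rightarrow> ('a \<Rightarrow> 'u set) \<Rightarrow> 'a \<Rightarrow> 'u set" where
  "soft_closure U A \<tau> F =
     soft_Inter U A {C \<in> soft_closed_sets U A \<tau>. soft_subset A F C}"

definition soft_interior ::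
    "'a set \<Rightarrow> ('a \<Rightarrow> 'u set) set \<Rightarrow> ('a \<Rightarrow> 'u set) \<Rightarrow> 'a \<Rightarrow> 'u set" where
  "soft_interior A \<tau> F = soft_Union A {H \<in> \<tau>. soft_subset A H F}"

definition soft_semiopen_sets ::
    "'u set \<Rightarrow> 'a set \<Rightarrow> ('a \<Rightarrow> 'u set) set \<Rightarrow> ('a \<Rightarrow> 'u set) set" where
  "soft_semiopen_sets U A \<tau> =
     {G \<in> soft_sets U A.
        \<exists>H\<in>\<tau>. soft_subset A H G \<and> soft_subset A G (soft_closure U A \<tau> H)}"

definition ssint ::
    "'u set \<Rightarrow> 'a set \<Rightarrow> ('a \<Rightarrow> 'u set) set \<Rightarrow> ('a \<Rightarrow> 'u set) \<Rightarrow> 'a \<Rightarrow> 'u set" where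
  "ssint U A \<tau> G = soft_Union A {H \<in> soft_semiopen_sets U A \<tau>. soft_subset A H G}"

text \<open>
  A soft function is the pair \<open>(u, p)\<close> of its underlying maps; the values of \<open>u\<close> off \<open>U\<close>
  and of \<open>p\<close> off \<open>A\<close> are irrelevant.
\<close>

definition soft_function ::
    "'u set \<Rightarrow> 'a set \<Rightarrow> 'b set \<Rightarrow> ('u \<Rightarrow> 'u) \<times> ('a \<Rightarrow> 'b) \<Rightarrow> bool" where
  "soft_function U A B f \<longleftrightarrow> fst f \<in> U \<rightarrow> U \<and> snd f \<in> A \<rightarrow> B"

definition soft_image ::
    "'a set \<Rightarrow> 'b set \<Rightarrow> ('u \<Rightarrow> 'u) \<times> ('a \<Rightarrow> 'b) \<Rightarrow> ('a \<Rightarrow> 'u set) \<Rightarrow> 'b \<Rightarrow> 'u set" where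
  "soft_image A B f F = (\<lambda>b\<in>B. \<Union>a\<in>{a\<in>A. snd f a = b}. fst f ` F a)"

definition soft_semiopen_function ::
    "'u set \<Rightarrow> 'a set \<Rightarrow> ('a \<Rightarrow> 'u set) set \<Rightarrow> 'b set \<Rightarrow> ('b \<Rightarrow> 'u set) set \<Rightarrow>
     ('u \<Rightarrow> 'u) \<times> ('a \<Rightarrow> 'b) \<Rightarrow> bool" where
  "soft_semiopen_function U A \<tau> B \<delta> f \<longleftrightarrow>
     (\<forall>G\<in>\<tau>. soft_image A B f G \<in> soft_semiopen_sets U B \<delta>)"

end

theory Submission
  imports Defs
begin

text \<open>
  Everything rests on one fact, \<open>soft_Union_semiopen\<close>: an arbitrary soft union of semiopen
  soft sets is semiopen, because the soft closure is monotone. Hence \<open>ssint G\<close> is itself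
  semiopen, and it is the largest semiopen soft set contained in \<open>G\<close>.

  If \<open>f\<close> is soft semiopen, then \<open>f(F\<^sup>0)\<close> is semiopen and contained in \<open>f(F)\<close>, hence contained
  in \<open>ssint (f(F))\<close>. Conversely, an open \<open>G\<close> equals its soft interior, so the inclusion gives
  \<open>f(G) \<subseteq> ssint (f(G)) \<subseteq> f(G)\<close>; thus \<open>f(G)\<close> coincides with its semi-interior and is semiopen.
\<close>

lemma soft_subset_refl: "soft_subset A F F"
  by (simp add: soft_subset_def)

lemma soft_subset_trans:
  "soft_subset A F G \<Longrightarrow> soft_subset A G H \<Longrightarrow> soft_subset A F H"
  by (auto simp: soft_subset_def)

lemma soft_subset_antisym:
  assumes "soft_subset A F G" "soft_subset A G F"
    and "F \<in> extensional A" "G \<in> extensional A"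
  shows "F = G"
  using assms by (auto simp: soft_subset_def intro!: extensionalityI[of F A G])

lemma soft_subset_soft_Union: "F \<in> S \<Longrightarrow> soft_subset A F (soft_Union A S)"
  by (auto simp: soft_subset_def soft_Union_def)

lemma soft_Union_least:
  "(\<And>F. F \<in> S \<Longrightarrow> soft_subset A F G) \<Longrightarrow> soft_subset A (soft_Union A S) G"
  by (auto simp: soft_subset_def soft_Union_def)

lemma soft_Union_extensional: "soft_Union A S \<in> extensional A"
  by (simp add: soft_Union_def)

lemma soft_Union_in_soft_sets:
  "S \<subseteq> soft_sets U A \<Longrightarrow> soft_Union A S \<in> soft_sets U A"
  unfolding soft_sets_def soft_Union_def by fastforce

lemma soft_closure_mono:
  "soft_subset A F G \<Longrightarrow> soft_subset A (soft_closure U A \<tau> F) (soft_closure U A \<tau> G)"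
  unfolding soft_closure_def soft_Inter_def soft_subset_def by auto blast

lemma soft_interior_open:
  "soft_topology U A \<tau> \<Longrightarrow> soft_interior A \<tau> F \<in> \<tau>"
  by (simp add: soft_topology_def soft_interior_def)

lemma soft_interior_subset: "soft_subset A (soft_interior A \<tau> F) F"
  unfolding soft_interior_def by (rule soft_Union_least) simp

lemma soft_interior_eq:
  assumes "soft_topology U A \<tau>" "G \<in> \<tau>"
  shows "soft_interior A \<tau> G = G"
proof (rule soft_subset_antisym)
  show "soft_subset A G (soft_interior A \<tau> G)"
    unfolding soft_interior_def
    using assms(2) by (intro soft_subset_soft_Union) (simp add: soft_subset_refl)
  show "G \<in> extensional A"
    using assms by (auto simp: soft_topology_def soft_sets_def PiE_def)
  show "soft_interior A \<tau> G \<in> extensional A"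
    by (simp add: soft_interior_def soft_Union_extensional)
qed (rule soft_interior_subset)

lemma soft_Union_semiopen:
  assumes top: "soft_topology U A \<tau>" and S: "S \<subseteq> soft_semiopen_sets U A \<tau>"
  shows "soft_Union A S \<in> soft_semiopen_sets U A \<tau>"
proof -
  \<comment> \<open>Taking all open soft sets that witness semiopenness of some member of \<open>S\<close>
    avoids choosing one witness for each member.\<close>
  define W where
    "W = {H \<in> \<tau>. \<exists>G\<in>S. soft_subset A H G \<and> soft_subset A G (soft_closure U A \<tau> H)}"
  have "soft_Union A W \<in> \<tau>"
    using top by (auto simp: soft_topology_def W_def)
  moreover have "soft_subset A (soft_Union A W) (soft_Union A S)"
  proof (rule soft_Union_least)
    fix H assume "H \<in> W"
    then obtain G where "G \<in> S" "soft_subset A H G"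
      by (auto simp: W_def)
    then show "soft_subset A H (soft_Union A S)"
      using soft_subset_trans soft_subset_soft_Union by metis
  qed
  moreover have "soft_subset A (soft_Union A S) (soft_closure U A \<tau> (soft_Union A W))"
  proof (rule soft_Union_least)
    fix G assume "G \<in> S"
    then obtain H where "H \<in> W" "soft_subset A G (soft_closure U A \<tau> H)"
      using S unfolding W_def soft_semiopen_sets_def by blast
    then show "soft_subset A G (soft_closure U A \<tau> (soft_Union A W))"
      using soft_subset_trans soft_closure_mono soft_subset_soft_Union by metis
  qed
  moreover have "soft_Union A S \<in> soft_sets U A"
    using S by (intro soft_Union_in_soft_sets) (auto simp: soft_semiopen_sets_def)
  ultimately show ?thesis
    by (auto simp: soft_semiopen_sets_def)
qed

lemma ssint_semiopen:
  "soft_topology U A \<tau> \<Longrightarrow> ssint U A \<tau> G \<in> soft_semiopen_sets U A \<tau>"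
  unfolding ssint_def by (rule soft_Union_semiopen) auto

lemma ssint_subset: "soft_subset A (ssint U A \<tau> G) G"
  unfolding ssint_def by (rule soft_Union_least) simp

lemma subset_ssint:
  "H \<in> soft_semiopen_sets U A \<tau> \<Longrightarrow> soft_subset A H G \<Longrightarrow> soft_subset A H (ssint U A \<tau> G)"
  unfolding ssint_def by (rule soft_subset_soft_Union) simp

lemma soft_image_mono:
  "soft_subset A F G \<Longrightarrow> soft_subset B (soft_image A B f F) (soft_image A B f G)"
  unfolding soft_subset_def soft_image_def by auto

theorem theorem3p5:
  fixes U :: "'u set" and A :: "'a set" and B :: "'b set"
    and \<tau> :: "('a \<Rightarrow> 'u set) set" and \<delta> :: "('b \<Rightarrow> 'u set) set"
    and f :: "('u \<Rightarrow> 'u) \<times> ('a \<Rightarrow> 'b)"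
  assumes "soft_topology U A \<tau>"
    and "soft_topology U B \<delta>"
    and "soft_function U A B f"
  shows "soft_semiopen_function U A \<tau> B \<delta> f \<longleftrightarrow>
    (\<forall>F \<in> soft_sets U A.
       soft_subset B (soft_image A B f (soft_interior A \<tau> F)) (ssint U B \<delta> (soft_image A B f F)))"
proof
  assume f: "soft_semiopen_function U A \<tau> B \<delta> f"
  show "\<forall>F \<in> soft_sets U A.
      soft_subset B (soft_image A B f (soft_interior A \<tau> F)) (ssint U B \<delta> (soft_image A B f F))"
  proof
    fix F
    have "soft_image A B f (soft_interior A \<tau> F) \<in> soft_semiopen_sets U B \<delta>"
      using f soft_interior_open[OF assms(1)] by (simp add: soft_semiopen_function_def)
    then show "soft_subset B (soft_image A B f (soft_interior A \<tau> F))
        (ssint U B \<delta> (soft_image A B f F))"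
      by (intro subset_ssint soft_image_mono soft_interior_subset)
  qed
next
  assume incl: "\<forall>F \<in> soft_sets U A.
      soft_subset B (soft_image A B f (soft_interior A \<tau> F)) (ssint U B \<delta> (soft_image A B f F))"
  show "soft_semiopen_function U A \<tau> B \<delta> f"
    unfolding soft_semiopen_function_def
  proof
    fix G assume G: "G \<in> \<tau>"
    then have "G \<in> soft_sets U A"
      using assms(1) by (auto simp: soft_topology_def)
    then have "soft_subset B (soft_image A B f G) (ssint U B \<delta> (soft_image A B f G))"
      using incl soft_interior_eq[OF assms(1) G] by metis
    moreover have "ssint U B \<delta> (soft_image A B f G) \<in> extensional B"
      by (simp add: ssint_def soft_Union_extensional)
    moreover have "soft_image A B f G \<in> extensional B"
      by (simp add: soft_image_def)
    ultimately have "ssint U B \<delta> (soft_image A B f G) = soft_image A B f G"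
      by (rule soft_subset_antisym[OF ssint_subset])
    then show "soft_image A B f G \<in> soft_semiopen_sets U B \<delta>"
      using ssint_semiopen[OF assms(2)] by metis
  qed
qed

end
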